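(* Let $\mathcal{A} = (a_{i_1\cdots i_m})$ be a real $m$th order $n$-dimensional strongly symmetric tensor, and let $\mathcal{A}^{(0)},\dots,\mathcal{A}^{(m)}$, $\mathcal{A}^{(k)}=(a^{(k)}_{i_1\cdots i_m})$, be the tensors produced from $\mathcal{A}$ by the hierarchical elimination algorithm. Then $\mathcal{A}^{(m)}=0$, i.e., $$\mathcal{A}=\sum_{k=0}^{m-1}\ \sum\left\{a^{(k)}_{i_1\cdots i_{m-k}\cdots i_{m-k}}\,(v^e)^m : e=(i_1,\dots,i_{m-k},\dots,i_{m-k})\in\mathcal{I}_{(m-k)+}(\mathcal{A}^{(k)})\right\}.$$ Thus, a real symmetric tensor has a symmetric binary decomposition if and only if it is strongly symmetric.
   Context: A real $m$th order $n$-dimensional tensor is an array $\mathcal{A} = (a_{i_1\cdots i_m})$ of real numbers indexed by $\mathcal{I}=\{(i_1,\dots,i_m): 1\le i_k\le n,\ k=1,\dots,m\}$; it is symmetric if its entries are invariant under any permutation of the indices. For $u\in\mathbb{R}^n$, $u^m$ denotes the rank-one tensor $(u_{i_1}\cdots u_{i_m})$. For $(i_1,\dots,i_m)\in\mathcal{I}$, $[(i_1,\dots,i_m)]$ is the set of distinct members of $\{i_1,\dots,i_m\}$; write $(i_1,\dots,i_m)\sim(j_1,\dots,j_m)$ if $[(i_1,\dots,i_m)]=[(j_1,\dots,j_m)]$. $\mathcal{A}$ is strongly symmetric if $a_{i_1\cdots i_m}=a_{j_1\cdots j_m}$ whenever $(i_1,\dots,i_m)\sim(j_1,\dots,j_m)$.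 A symmetric tensor $\mathcal{A}$ has a symmetric binary decomposition if $\mathcal{A}=\sum_{k=1}^r\alpha_k(v^{(k)})^m$ for some real numbers $\alpha_k$ and binary vectors (vectors with all entries in $\{0,1\}$) $v^{(k)}\in\mathbb{R}^n$, $k=1,\dots,r$. For $k=1,\dots,m$, $\mathcal{I}_{k+}$ is the set of tuples $(i_1,\dots,i_k,i_k,\dots,i_k)\in\mathcal{I}$ (the last index $i_k$ repeated to fill length $m$) with $1\le i_1<i_2<\cdots<i_k\le n$. For a tensor $\mathcal{A}$, $\mathcal{I}_{k+}(\mathcal{A})$ is the set of those $(i_1,\dots,i_k,i_k,\dots,i_k)\in\mathcal{I}_{k+}$ with $a_{i_1\cdots i_ki_k\cdots i_k}\ne 0$. Hierarchical elimination algorithm: set $\mathcal{A}^{(0)}=\mathcal{A}$. For $k=0,1,\dots,m-1$ successively: for each $e=(i_1,\dots,i_{m-k},\dots,i_{m-k})\in\mathcal{I}_{(m-k)+}(\mathcal{A}^{(k)})$ let $v^e\in\mathbb{R}^n$ be the binary vector with $v^e_i=1$ if $i\in\{i_1,\dots,i_{m-k}\}$ and $v^e_i=0$ otherwise, and set $$\mathcal{A}^{(k+1)}=\mathcal{A}^{(k)}-\sum\left\{a^{(k)}_{i_1\cdots i_{m-k}\cdots i_{m-k}}\,(v^e)^m : e=(i_1,\dots,i_{m-k},\dots,i_{m-k})\in\mathcal{I}_{(m-k)+}(\mathcal{A}^{(k)})\right\},$$ where $a^{(k)}_{i_1\cdots i_m}$ are the entries of $\mathcal{A}^{(k)}$ and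 empty sums are zero. *)

theory Defs
  imports Complex_Main "HOL-Combinatorics.Permutations"
begin

text \<open>
  An order \<open>m\<close>, dimension \<open>n\<close> tensor is a function on index tuples, represented as lists of
  length \<open>m\<close> over \<open>{1..n}\<close>; its values outside \<open>indices m n\<close> carry no meaning. Likewise a vector
  of dimension \<open>n\<close> is a function on \<open>nat\<close> of which only the values on \<open>{1..n}\<close> matter.
  Consequently, tensors are compared with \<open>tensor_eq m n\<close> rather than with HOL equality.
\<close>

type_synonym tensor = "nat list \<Rightarrow> real"

definition indices :: "nat \<Rightarrow> nat \<Rightarrow> nat list set" where
  "indices m n = {i. length i = m \<and> set i \<subseteq> {1..n}}"

definition tensor_eq :: "nat \<Rightarrow> nat \<Rightarrow> tensor \<Rightarrow> tensor \<Rightarrow> bool" where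
  "tensor_eq m n A B \<longleftrightarrow> (\<forall>i\<in>indices m n. A i = B i)"

definition symmetric_tensor :: "nat \<Rightarrow> nat \<Rightarrow> tensor \<Rightarrow> bool" where
  "symmetric_tensor m n A \<longleftrightarrow>
     (\<forall>i\<in>indices m n. \<forall>p. p permutes {..<m} \<longrightarrow> A (permute_list p i) = A i)"

definition strongly_symmetric :: "nat \<Rightarrow> nat \<Rightarrow> tensor \<Rightarrow> bool" where
  "strongly_symmetric m n A \<longleftrightarrow>
     (\<forall>i\<in>indices m n. \<forall>j\<in>indices m n. set i = set j \<longrightarrow> A i = A j)"

text \<open>The order of the rank-one tensor is the length of the index tuple it is applied to.\<close>

definition rank_one :: "(nat \<Rightarrow> real) \<Rightarrow> tensor" where
  "rank_one u = (\<lambda>i. prod_list (map u i))"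

definition binary_vector :: "nat \<Rightarrow> (nat \<Rightarrow> real) \<Rightarrow> bool" where
  "binary_vector n v \<longleftrightarrow> (\<forall>i\<in>{1..n}. v i \<in> {0, 1})"

definition has_symmetric_binary_decomposition :: "nat \<Rightarrow> nat \<Rightarrow> tensor \<Rightarrow> bool" where
  "has_symmetric_binary_decomposition m n A \<longleftrightarrow>
     (\<exists>(r::nat) (\<alpha> :: nat \<Rightarrow> real) (v :: nat \<Rightarrow> nat \<Rightarrow> real).
        (\<forall>k\<in>{1..r}. binary_vector n (v k)) \<and>
        tensor_eq m n A (\<lambda>i. \<Sum>k=1..r. \<alpha> k * rank_one (v k) i))"

text \<open>
  Tuples \<open>(i\<^sub>1, \<dots>, i\<^sub>k, i\<^sub>k, \<dots>, i\<^sub>k)\<close> with \<open>i\<^sub>1 < \<dots> < i\<^sub>k\<close>; meaningful for \<open>1 \<le> k \<le> m\<close>.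
\<close>

definition indices_plus :: "nat \<Rightarrow> nat \<Rightarrow> nat \<Rightarrow> nat list set" where
  "indices_plus m n k =
     {xs @ replicate (m - k) (last xs) | xs.
        length xs = k \<and> sorted_wrt (<) xs \<and> set xs \<subseteq> {1..n}}"

definition indices_plus_nz :: "nat \<Rightarrow> nat \<Rightarrow> nat \<Rightarrow> tensor \<Rightarrow> nat list set" where
  "indices_plus_nz m n k A = {e \<in> indices_plus m n k. A e \<noteq> 0}"

definition support_vector :: "nat list \<Rightarrow> nat \<Rightarrow> real" where
  "support_vector e = (\<lambda>i. if i \<in> set e then 1 else 0)"

text \<open>\<open>elim_step m n k A\<close> is the tensor subtracted at step \<open>k < m\<close> from the current tensor \<open>A\<close>.\<close>

definition elim_step :: "nat \<Rightarrow> nat \<Rightarrow> nat \<Rightarrow> tensor \<Rightarrow> tensor" where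
  "elim_step m n k A =
     (\<lambda>i. \<Sum>e\<in>indices_plus_nz m n (m - k) A. A e * rank_one (support_vector e) i)"

text \<open>Only the iterates \<open>0, \<dots>, m\<close> belong to the algorithm.\<close>

primrec hier_elim :: "nat \<Rightarrow> nat \<Rightarrow> tensor \<Rightarrow> nat \<Rightarrow> tensor" where
  "hier_elim m n A 0 = A"
| "hier_elim m n A (Suc k) =
     (\<lambda>i. hier_elim m n A k i - elim_step m n k (hier_elim m n A k) i)"

end

theory Submission
  imports Defs
begin

text \<open>
  For a binary vector \<open>v\<close> with support \<open>S\<close>, the entry of \<open>v\<^sup>m\<close> at an index tuple \<open>i\<close> is \<open>1\<close> if
  \<open>set i \<subseteq> S\<close> and \<open>0\<close> otherwise (\<open>rank_one_binary\<close>). So it depends on \<open>i\<close> only through \<open>set i\<close>,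
  which already makes every tensor with a binary decomposition strongly symmetric.

  For the converse, regard a strongly symmetric tensor as a function on the nonempty subsets of
  \<open>{1..n}\<close> with at most \<open>m\<close> elements. The set \<open>\<I>\<^sub>c\<^sub>+\<close> contains exactly one tuple for each subset of
  size \<open>c\<close> (\<open>set_indices_plus\<close>, \<open>indices_plus_unique\<close>, \<open>indices_plus_exists\<close>), and subtracting the
  multiple of \<open>(v\<^sup>e)\<^sup>m\<close> alters only the values at subsets of \<open>set e\<close>. Elimination at size \<open>c\<close>
  therefore annihilates all values at sets of size \<open>c\<close> and leaves those at larger sets unchanged. As
  the sizes are treated in the order \<open>m, m - 1, \<dots>, 1\<close>, what has been annihilated stays zero, and
  after step \<open>k\<close> the tensor vanishes at all tuples with at least \<open>m - k\<close> distinct entries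
  (\<open>hier_elim_invariant\<close>). After step \<open>m - 1\<close> nothing remains, because a tuple of length \<open>m \<ge> 1\<close> has
  at least one entry. Adding up everything that was subtracted gives the decomposition.
\<close>

section \<open>Rank-one tensors of binary vectors\<close>

lemma rank_one_binary:
  assumes "binary_vector n v" "set i \<subseteq> {1..n}"
  shows "rank_one v i = (if \<forall>x\<in>set i. v x = 1 then 1 else 0)"
  using assms(2)
proof (induction i)
  case Nil
  show ?case by (simp add: rank_one_def)
next
  case (Cons a i)
  then have "v a \<in> {0, 1}" using assms(1) by (auto simp: binary_vector_def)
  with Cons show ?case by (auto simp: rank_one_def)
qed

lemma binary_vector_support_vector: "binary_vector n (support_vector e)"
  by (simp add: binary_vector_def support_vector_def)

lemma rank_one_support_vector:
  assumes "i \<in> indices m n"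
  shows "rank_one (support_vector e) i = (if set i \<subseteq> set e then 1 else 0)"
  using rank_one_binary[OF binary_vector_support_vector, of i n e] assms
  by (auto simp: indices_def support_vector_def)

lemma binary_decomposition_imp_strongly_symmetric:
  assumes "has_symmetric_binary_decomposition m n A"
  shows "strongly_symmetric m n A"
proof -
  obtain r \<alpha> v where bin: "\<forall>k\<in>{1..r::nat}. binary_vector n (v k)"
    and dec: "tensor_eq m n A (\<lambda>i. \<Sum>k=1..r. \<alpha> k * rank_one (v k) i)"
    using assms unfolding has_symmetric_binary_decomposition_def by blast
  show ?thesis
    unfolding strongly_symmetric_def
  proof (intro ballI impI)
    fix i j assume ij: "i \<in> indices m n" "j \<in> indices m n" "set i = set j"
    have "rank_one (v k) i = rank_one (v k) j" if "k \<in> {1..r}" for k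
      using ij bin that by (simp add: rank_one_binary[of n "v k"] indices_def)
    then have "(\<Sum>k=1..r. \<alpha> k * rank_one (v k) i) = (\<Sum>k=1..r. \<alpha> k * rank_one (v k) j)"
      by (intro sum.cong) auto
    then show "A i = A j" using dec ij by (simp add: tensor_eq_def)
  qed
qed

text \<open>
  Decompositions are numbered from \<open>1\<close> to \<open>r\<close>, whereas the terms of the algorithm are naturally
  indexed by pairs of a step and a tuple; any finite index set may be renumbered.
\<close>

lemma has_symmetric_binary_decompositionI:
  assumes "finite S" "\<And>s. s \<in> S \<Longrightarrow> binary_vector n (w s)"
    and "tensor_eq m n A (\<lambda>i. \<Sum>s\<in>S. \<beta> s * rank_one (w s) i)"
  shows "has_symmetric_binary_decomposition m n A"
proof -
  obtain h where h: "bij_betw h {1..card S} S"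
    using ex_bij_betw_nat_finite_1[OF assms(1)] by blast
  have "(\<Sum>s\<in>S. \<beta> s * rank_one (w s) i) =
      (\<Sum>k=1..card S. (\<beta> \<circ> h) k * rank_one ((w \<circ> h) k) i)" for i
    using sum.reindex_bij_betw[OF h, of "\<lambda>s. \<beta> s * rank_one (w s) i"] by simp
  then have "tensor_eq m n A (\<lambda>i. \<Sum>k=1..card S. (\<beta> \<circ> h) k * rank_one ((w \<circ> h) k) i)"
    using assms(3) by simp
  moreover have "\<forall>k\<in>{1..card S}. binary_vector n ((w \<circ> h) k)"
    using assms(2) bij_betwE[OF h] by auto
  ultimately show ?thesis
    unfolding has_symmetric_binary_decomposition_def by blast
qed

section \<open>Tuples representing the subsets of a given size\<close>

lemma set_append_replicate_last:
  assumes "xs \<noteq> []"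
  shows "set (xs @ replicate l (last xs)) = set xs"
  using last_in_set[OF assms] by auto

lemma set_indices_plus:
  assumes "e \<in> indices_plus m n c" "1 \<le> c" "c \<le> m"
  shows "e \<in> indices m n" "card (set e) = c"
proof -
  obtain xs where xs: "e = xs @ replicate (m - c) (last xs)" "length xs = c"
      "sorted_wrt (<) xs" "set xs \<subseteq> {1..n}"
    using assms(1) unfolding indices_plus_def by blast
  have se: "set e = set xs"
    unfolding xs(1) using xs(2) assms(2) by (intro set_append_replicate_last) auto
  then show "e \<in> indices m n" using xs assms(3) by (simp add: indices_def)
  show "card (set e) = c"
    using se xs(2,3) by (simp add: strict_sorted_iff distinct_card)
qed

lemma indices_plus_unique:
  assumes "e \<in> indices_plus m n c" "e' \<in> indices_plus m n c" "1 \<le> c" "set e = set e'"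
  shows "e = e'"
proof -
  obtain xs where xs: "e = xs @ replicate (m - c) (last xs)" "length xs = c" "sorted_wrt (<) xs"
    using assms(1) unfolding indices_plus_def by blast
  obtain ys where ys: "e' = ys @ replicate (m - c) (last ys)" "length ys = c" "sorted_wrt (<) ys"
    using assms(2) unfolding indices_plus_def by blast
  have "xs \<noteq> []" "ys \<noteq> []" using xs(2) ys(2) assms(3) by auto
  then have "set xs = set ys"
    using assms(4) set_append_replicate_last unfolding xs(1) ys(1) by metis
  then have "xs = ys" using strict_sorted_equal[OF xs(3) ys(3)] by simp
  then show ?thesis using xs(1) ys(1) by simp
qed

lemma indices_plus_exists:
  assumes "S \<subseteq> {1..n}" "card S = c" "1 \<le> c"
  obtains e where "e \<in> indices_plus m n c" "set e = S"
proof -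
  let ?xs = "sorted_list_of_set S"
  have fin: "finite S" using assms(1) finite_subset by blast
  have ne: "?xs \<noteq> []" using assms(2,3) fin by auto
  show thesis
  proof
    show "?xs @ replicate (m - c) (last ?xs) \<in> indices_plus m n c"
      unfolding indices_plus_def using assms fin
      by (intro CollectI exI[of _ ?xs]) simp
    show "set (?xs @ replicate (m - c) (last ?xs)) = S"
      using set_append_replicate_last[OF ne] fin by simp
  qed
qed

lemma finite_indices_plus: "finite (indices_plus m n c)"
proof -
  have "indices_plus m n c \<subseteq>
      (\<lambda>xs. xs @ replicate (m - c) (last xs)) ` {xs. set xs \<subseteq> {1..n} \<and> length xs = c}"
    by (auto simp: indices_plus_def)
  then show ?thesis
    by (rule finite_subset) (simp add: finite_lists_length_eq)
qed

lemma finite_indices_plus_nz: "finite (indices_plus_nz m n c B)"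
  using finite_indices_plus by (simp add: indices_plus_nz_def)

section \<open>The elimination\<close>

text \<open>
  Terms with a vanishing coefficient may be included, so that the index set no longer depends on
  the current tensor.
\<close>

lemma elim_step_eq:
  assumes "i \<in> indices m n"
  shows "elim_step m n k B i =
    (\<Sum>e\<in>indices_plus m n (m - k). if set i \<subseteq> set e then B e else 0)"
proof -
  have "elim_step m n k B i =
      (\<Sum>e\<in>indices_plus_nz m n (m - k) B. if set i \<subseteq> set e then B e else 0)"
    unfolding elim_step_def rank_one_support_vector[OF assms] by (intro sum.cong) auto
  also have "\<dots> = (\<Sum>e\<in>indices_plus m n (m - k). if set i \<subseteq> set e then B e else 0)"
    using finite_indices_plus by (intro sum.mono_neutral_left) (auto simp: indices_plus_nz_def)
  finally show ?thesis .
qed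

lemma elim_step_large:
  assumes "i \<in> indices m n" "k < m" "card (set i) > m - k"
  shows "elim_step m n k B i = 0"
proof -
  have "\<not> set i \<subseteq> set e" if "e \<in> indices_plus m n (m - k)" for e
    using set_indices_plus(2)[OF that] assms(2,3) card_mono[of "set e" "set i"] by auto
  then show ?thesis unfolding elim_step_eq[OF assms(1)] by (intro sum.neutral) auto
qed

text \<open>
  Among sets of equal size inclusion is equality, so only the tuple representing \<open>set i\<close> itself
  contributes, and strong symmetry identifies the entry there with the one at \<open>i\<close>.
\<close>

lemma elim_step_exact:
  assumes "strongly_symmetric m n B" "i \<in> indices m n" "k < m" "card (set i) = m - k"
  shows "elim_step m n k B i = B i"
proof -
  have c: "1 \<le> m - k" "m - k \<le> m" using assms(3) by auto
  have "set i \<subseteq> {1..n}" using assms(2) by (simp add: indices_def)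
  then obtain e0 where e0: "e0 \<in> indices_plus m n (m - k)" "set e0 = set i"
    using indices_plus_exists[OF _ assms(4) c(1)] by metis
  have only: "set i \<subseteq> set e \<longleftrightarrow> e = e0" if e: "e \<in> indices_plus m n (m - k)" for e
  proof
    assume "set i \<subseteq> set e"
    then have "set i = set e"
      using set_indices_plus(2)[OF e c] assms(4) by (intro card_subset_eq) auto
    then show "e = e0" using indices_plus_unique[OF e e0(1) c(1)] e0(2) by simp
  qed (use e0 in simp)
  have "elim_step m n k B i = (\<Sum>e\<in>indices_plus m n (m - k). if e = e0 then B e else 0)"
    unfolding elim_step_eq[OF assms(2)] using only by (intro sum.cong) auto
  also have "\<dots> = B e0"
    using e0(1) finite_indices_plus by simp
  also have "\<dots> = B i"
    using assms(1,2) set_indices_plus(1)[OF e0(1) c] e0(2) unfolding strongly_symmetric_def by blast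
  finally show ?thesis .
qed

text \<open>
  Strong symmetry has to be carried along: it is what makes the entry eliminated at one
  representing tuple vanish at all tuples with the same underlying set.
\<close>

lemma hier_elim_invariant:
  assumes "strongly_symmetric m n A" "k \<le> m"
  shows "strongly_symmetric m n (hier_elim m n A k) \<and>
    (\<forall>i\<in>indices m n. card (set i) > m - k \<longrightarrow> hier_elim m n A k i = 0)"
  using assms(2)
proof (induction k)
  case 0
  have "card (set i) \<le> m" if "i \<in> indices m n" for i
    using that card_length[of i] by (simp add: indices_def)
  then show ?case using assms(1) by fastforce
next
  case (Suc k)
  let ?B = "hier_elim m n A k"
  have k: "k < m" using Suc.prems by simp
  have sym: "strongly_symmetric m n ?B"
    and zero: "\<And>i. i \<in> indices m n \<Longrightarrow> card (set i) > m - k \<Longrightarrow> ?B i = 0"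
    using Suc by auto
  have "hier_elim m n A (Suc k) i = hier_elim m n A (Suc k) j"
    if ij: "i \<in> indices m n" "j \<in> indices m n" "set i = set j" for i j
  proof -
    have "?B i = ?B j" using sym ij unfolding strongly_symmetric_def by blast
    then show ?thesis using ij by (simp add: elim_step_eq)
  qed
  moreover have "hier_elim m n A (Suc k) i = 0"
    if i: "i \<in> indices m n" "card (set i) > m - Suc k" for i
  proof (cases "card (set i) = m - k")
    case True
    then show ?thesis using elim_step_exact[OF sym i(1) k] by simp
  next
    case False
    then have "card (set i) > m - k" using i(2) k by linarith
    then show ?thesis using elim_step_large[OF i(1) k] zero i(1) by simp
  qed
  ultimately show ?case unfolding strongly_symmetric_def by blast
qed

lemma hier_elim_final:
  assumes "m \<ge> 1" "strongly_symmetric m n A" "i \<in> indices m n"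
  shows "hier_elim m n A m i = 0"
proof -
  have "i \<noteq> []" using assms(1,3) by (auto simp: indices_def)
  then have "card (set i) > m - m" by (simp add: card_gt_0_iff)
  then show ?thesis using hier_elim_invariant[OF assms(2) order_refl] assms(3) by blast
qed

lemma hier_elim_telescope:
  "A i = hier_elim m n A k i + (\<Sum>l<k. elim_step m n l (hier_elim m n A l) i)"
  by (induction k) auto

lemma hier_elim_decomposition:
  assumes "m \<ge> 1" "strongly_symmetric m n A"
  shows "tensor_eq m n A
    (\<lambda>i. \<Sum>k=0..m-1. \<Sum>e\<in>indices_plus_nz m n (m - k) (hier_elim m n A k).
       hier_elim m n A k e * rank_one (support_vector e) i)"
proof -
  have steps: "{..<m} = {0..m-1}" using assms(1) by auto
  show ?thesis
    unfolding tensor_eq_def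
  proof
    fix i assume "i \<in> indices m n"
    then have "A i = (\<Sum>l<m. elim_step m n l (hier_elim m n A l) i)"
      using hier_elim_telescope[of A i m n m] hier_elim_final[OF assms] by simp
    then show "A i = (\<Sum>k=0..m-1. \<Sum>e\<in>indices_plus_nz m n (m - k) (hier_elim m n A k).
        hier_elim m n A k e * rank_one (support_vector e) i)"
      by (simp only: steps elim_step_def)
  qed
qed

lemma strongly_symmetric_imp_binary_decomposition:
  assumes "m \<ge> 1" "strongly_symmetric m n A"
  shows "has_symmetric_binary_decomposition m n A"
proof -
  let ?S = "SIGMA k:{0..m-1}. indices_plus_nz m n (m - k) (hier_elim m n A k)"
  have flat: "(\<Sum>k=0..m-1. \<Sum>e\<in>indices_plus_nz m n (m - k) (hier_elim m n A k).
        hier_elim m n A k e * rank_one (support_vector e) i) =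
      (\<Sum>s\<in>?S. hier_elim m n A (fst s) (snd s) * rank_one (support_vector (snd s)) i)" for i
    by (subst sum.Sigma) (auto simp: finite_indices_plus_nz case_prod_beta)
  show ?thesis
  proof (rule has_symmetric_binary_decompositionI)
    show "finite ?S" by (simp add: finite_indices_plus_nz)
    show "binary_vector n (support_vector (snd s))" for s :: "nat \<times> nat list"
      by (rule binary_vector_support_vector)
    show "tensor_eq m n A
        (\<lambda>i. \<Sum>s\<in>?S. hier_elim m n A (fst s) (snd s) * rank_one (support_vector (snd s)) i)"
      using hier_elim_decomposition[OF assms] unfolding flat .
  qed
qed

theorem theorem6:
  fixes m n :: nat
  assumes "m \<ge> 1"
  shows "(\<forall>A :: tensor. strongly_symmetric m n A \<longrightarrow>
            tensor_eq m n (hier_elim m n A m) (\<lambda>_. 0) \<and>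
            tensor_eq m n A
              (\<lambda>i. \<Sum>k=0..m-1. \<Sum>e\<in>indices_plus_nz m n (m - k) (hier_elim m n A k).
                 hier_elim m n A k e * rank_one (support_vector e) i))
       \<and> (\<forall>A :: tensor. symmetric_tensor m n A \<longrightarrow>
            (has_symmetric_binary_decomposition m n A \<longleftrightarrow> strongly_symmetric m n A))"
proof (intro conjI allI impI)
  fix A :: tensor assume A: "strongly_symmetric m n A"
  show "tensor_eq m n (hier_elim m n A m) (\<lambda>_. 0)"
    using hier_elim_final[OF assms A] by (simp add: tensor_eq_def)
  show "tensor_eq m n A
      (\<lambda>i. \<Sum>k=0..m-1. \<Sum>e\<in>indices_plus_nz m n (m - k) (hier_elim m n A k).
         hier_elim m n A k e * rank_one (support_vector e) i)"
    using hier_elim_decomposition[OF assms A] .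
next
  fix A :: tensor
  show "has_symmetric_binary_decomposition m n A \<longleftrightarrow> strongly_symmetric m n A"
    using binary_decomposition_imp_strongly_symmetric
      strongly_symmetric_imp_binary_decomposition[OF assms] by blast
qed

end
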